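(* Let $N=2$ and $n\ge1$. Suppose $\phi\ge0$ is a smooth radially decreasing (i.e. non-increasing in $|x|$) kernel on $\mathbb{R}^n$ with $\phi(x)>0$ for $|x|<r_0$ and $\phi(x)=0$ for $|x|\ge r_0$, where $r_0>0$, and let $U(x)=\frac12|x|^2$. Consider the system $$\dot x_i=v_i,\qquad \dot v_i=\frac12\sum_{j=1}^2\phi(x_i-x_j)(v_j-v_i)-\nabla U(x_i),\qquad i=1,2,$$ with initial data $(\mathbf{x}_0,\mathbf{v}_0)\in\mathbb{R}^{2n}\times\mathbb{R}^{2n}$, and let $$\mathcal{H}=\{(\mathbf{x}_0,\mathbf{v}_0)\in\mathbb{R}^{2n}\times\mathbb{R}^{2n}:\ |x_1(t)-x_2(t)|\ge r_0\ \ \forall t\ge0\}.$$ Then for Lebesgue-almost every initial datum $(\mathbf{x}_0,\mathbf{v}_0)\in(\mathbb{R}^{2n}\times\mathbb{R}^{2n})\setminus\mathcal{H}$ the solution aligns and aggregates: $$|x_1(t)-x_2(t)|+|v_1(t)-v_2(t)|\to0\quad\text{as }t\to\infty.$$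
   Context: $\mathbf{x}=(x_1,x_2)$, $\mathbf{v}=(v_1,v_2)$ with $x_i,v_i\in\mathbb{R}^n$; $(\mathbf{x}(t),\mathbf{v}(t))$ denotes the solution with initial datum $(\mathbf{x}_0,\mathbf{v}_0)$. *)

theory Defs
  imports "HOL-Analysis.Analysis"
begin

text \<open>\<open>C_k k f\<close>: \<open>f\<close> is \<open>k\<close> times continuously differentiable on the whole space, expressed
  recursively through its first-order partial derivatives.\<close>

primrec C_k :: "nat \<Rightarrow> ('a::euclidean_space \<Rightarrow> real) \<Rightarrow> bool" where
  "C_k 0 f \<longleftrightarrow> continuous_on UNIV f"
| "C_k (Suc k) f \<longleftrightarrow>
     f differentiable_on UNIV \<and> (\<forall>b\<in>Basis. C_k k (\<lambda>x. frechet_derivative f (at x) b))"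

definition smooth :: "('a::euclidean_space \<Rightarrow> real) \<Rightarrow> bool" where
  "smooth f \<longleftrightarrow> (\<forall>k. C_k k f)"

definition radially_decreasing :: "('a::real_normed_vector \<Rightarrow> real) \<Rightarrow> bool" where
  "radially_decreasing f \<longleftrightarrow> (\<forall>x y. norm x \<le> norm y \<longrightarrow> f y \<le> f x)"

definition gradient :: "('a::real_inner \<Rightarrow> real) \<Rightarrow> 'a \<Rightarrow> 'a" where
  "gradient f x = (THE D. GDERIV f x :> D)"

definition U :: "'a::real_inner \<Rightarrow> real" where
  "U x = 1 / 2 * (norm x)\<^sup>2"

text \<open>A configuration \<open>x = (x\<^sub>1, x\<^sub>2)\<close> of two agents is an element of \<open>(real ^ 'n) ^ 2\<close> with agents
  \<open>x $ 1\<close> and \<open>x $ 2\<close>; a phase point is a pair (positions, velocities). At \<open>t = 0\<close> the derivatives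
  are one-sided.\<close>

definition is_solution ::
  "(real ^ 'n \<Rightarrow> real) \<Rightarrow> (real \<Rightarrow> real ^ 'n ^ 2) \<Rightarrow> (real \<Rightarrow> real ^ 'n ^ 2) \<Rightarrow> bool" where
  "is_solution \<phi> x v \<longleftrightarrow> (\<forall>t\<ge>0. \<forall>i.
     ((\<lambda>s. x s $ i) has_vector_derivative v t $ i) (at t within {0..}) \<and>
     ((\<lambda>s. v s $ i) has_vector_derivative
        (1 / 2) *\<^sub>R (\<Sum>j\<in>UNIV. \<phi> (x t $ i - x t $ j) *\<^sub>R (v t $ j - v t $ i))
          - gradient U (x t $ i)) (at t within {0..}))"

text \<open>\<open>flow \<phi> z\<^sub>0 t\<close> is the value at time \<open>t \<ge> 0\<close> of the solution with initial datum \<open>z\<^sub>0\<close>. The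
  description is applied at a fixed time because \<open>is_solution\<close> says nothing about negative times,
  so that a solution is not unique as a function on all of \<open>\<real>\<close>.\<close>

definition flow ::
  "(real ^ 'n \<Rightarrow> real) \<Rightarrow> (real ^ 'n ^ 2) \<times> (real ^ 'n ^ 2) \<Rightarrow> real
    \<Rightarrow> (real ^ 'n ^ 2) \<times> (real ^ 'n ^ 2)" where
  "flow \<phi> z\<^sub>0 t = (THE w. \<exists>x v. is_solution \<phi> x v \<and> (x 0, v 0) = z\<^sub>0 \<and> (x t, v t) = w)"

definition pos :: "(real ^ 'n \<Rightarrow> real) \<Rightarrow> (real ^ 'n ^ 2) \<times> (real ^ 'n ^ 2) \<Rightarrow> real \<Rightarrow> real ^ 'n ^ 2" where
  "pos \<phi> z\<^sub>0 t = fst (flow \<phi> z\<^sub>0 t)"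

definition vel :: "(real ^ 'n \<Rightarrow> real) \<Rightarrow> (real ^ 'n ^ 2) \<times> (real ^ 'n ^ 2) \<Rightarrow> real \<Rightarrow> real ^ 'n ^ 2" where
  "vel \<phi> z\<^sub>0 t = snd (flow \<phi> z\<^sub>0 t)"

definition non_interacting ::
  "(real ^ 'n \<Rightarrow> real) \<Rightarrow> real \<Rightarrow> ((real ^ 'n ^ 2) \<times> (real ^ 'n ^ 2)) set" where
  "non_interacting \<phi> r\<^sub>0 = {z\<^sub>0. \<forall>t\<ge>0. norm (pos \<phi> z\<^sub>0 t $ 1 - pos \<phi> z\<^sub>0 t $ 2) \<ge> r\<^sub>0}"

end

theory Submission
  imports Defs
begin

text \<open>
  The sum of the two agents is a free harmonic oscillator, so everything happens in the relative
  coordinates \<open>y = x\<^sub>1 - x\<^sub>2\<close>, \<open>w = v\<^sub>1 - v\<^sub>2\<close>, which satisfy \<open>y' = w\<close>, \<open>w' = - \<phi>(y) w - y\<close>.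
  Every component obeys the same damped scalar equation, hence \<open>(e \<bullet> y)\<^sup>2 + (e \<bullet> w)\<^sup>2\<close> is
  non-increasing for \<^emph>\<open>every\<close> vector \<open>e\<close>. The dissipation \<open>\<phi>(y) |w|\<^sup>2\<close> tends to zero by Barbalat's lemma,
  so along a subsequence of the times \<open>2\<pi>k\<close> the solution converges to a free oscillation
  \<open>Y\<^sub>s = cos s Y + sin s W\<close>, \<open>W\<^sub>s = Y\<^sub>s'\<close>, with \<open>\<phi>(Y\<^sub>s) W\<^sub>s = 0\<close> for all \<open>s\<close>. If \<open>|y(T)| < r\<^sub>0\<close>,
  choose \<open>s\<close> with \<open>Y\<^sub>s\<close> orthogonal to \<open>w(T)\<close> and take \<open>e = Y\<^sub>s\<close>: monotonicity gives
  \<open>|Y\<^sub>s|\<^sup>4 \<le> (Y\<^sub>s \<bullet> y(T))\<^sup>2\<close>, so \<open>|Y\<^sub>s| \<le> |y(T)| < r\<^sub>0\<close> and \<open>W\<^sub>s = 0\<close>. A quarter period later the limit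
  passes through the origin, where \<open>\<phi> > 0\<close>, with velocity \<open>- Y\<^sub>s\<close>; hence \<open>Y\<^sub>s = 0\<close> and the energy
  tends to zero.
\<close>

subsection \<open>Ordinary differential equations on the half line\<close>

text \<open>For t > 0 the filter \<open>at t within {0..}\<close> is the full one, so the usual
  monotonicity criterion applies on the open interval. Continuity covers the endpoints, among them
  0, where the derivative is only one-sided.\<close>

lemma nonincreasing_on_half_line:
  fixes f :: "real \<Rightarrow> real"
  assumes "\<And>t. t \<ge> 0 \<Longrightarrow> (f has_vector_derivative f' t) (at t within {0..})"
    and "\<And>t. a < t \<Longrightarrow> t < b \<Longrightarrow> f' t \<le> 0"
    and "0 \<le> a" "a \<le> b"
  shows "f b \<le> f a"
proof (rule DERIV_nonpos_imp_decreasing_open[OF \<open>a \<le> b\<close>])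
  fix t assume "a < t" "t < b"
  with assms(3) have "at t within {0..} = at t"
    by (intro at_within_interior) (auto simp: interior_real_atLeast)
  then show "\<exists>y. DERIV f t :> y \<and> y \<le> 0"
    using assms(1,2)[of t] \<open>a < t\<close> \<open>t < b\<close> assms(3)
    by (auto simp: has_real_derivative_iff_has_vector_derivative)
next
  have "continuous_on {0..} f"
    using assms(1) has_vector_derivative_continuous
    by (force simp: continuous_on_eq_continuous_within)
  then show "continuous_on {a..b} f"
    by (rule continuous_on_subset) (use assms(3) in auto)
qed

lemma has_vector_derivative_inner:
  assumes "(f has_vector_derivative f') (at t within S)"
    and "(g has_vector_derivative g') (at t within S)"
  shows "((\<lambda>t. f t \<bullet> g t) has_vector_derivative (f t \<bullet> g' + f' \<bullet> g t)) (at t within S)"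
  using has_derivative_inner[OF assms[unfolded has_vector_derivative_def]]
  by (simp add: has_vector_derivative_def algebra_simps)

text \<open>Gronwall argument: the squared distance of two solutions grows at most at rate 2L, so
  its product with exp(-2Lt) is non-increasing; it starts at 0 and is nonnegative.\<close>

lemma lipschitz_ode_unique:
  fixes F :: "'a::real_inner \<Rightarrow> 'a"
  assumes L: "L-lipschitz_on UNIV F"
    and z: "\<And>t. t \<ge> 0 \<Longrightarrow> (z has_vector_derivative F (z t)) (at t within {0..})"
    and z': "\<And>t. t \<ge> 0 \<Longrightarrow> (z' has_vector_derivative F (z' t)) (at t within {0..})"
    and init: "z 0 = z' 0" and "t \<ge> 0"
  shows "z t = z' t"
proof -
  define d where "d s = exp (- 2 * L * s) * ((z s - z' s) \<bullet> (z s - z' s))" for s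
  define d' where "d' s = 2 * exp (- 2 * L * s) *
    ((F (z s) - F (z' s)) \<bullet> (z s - z' s) - L * ((z s - z' s) \<bullet> (z s - z' s)))" for s
  have e: "((\<lambda>s. exp (- 2 * L * s)) has_vector_derivative - 2 * L * exp (- 2 * L * s))
      (at s within {0..})" for s
    unfolding has_real_derivative_iff_has_vector_derivative[symmetric]
    by (auto intro!: derivative_eq_intros)
  have "d t \<le> d 0"
  proof (rule nonincreasing_on_half_line[where f = d and f' = d'])
    fix s :: real assume s: "s \<ge> 0"
    have "((\<lambda>s. z s - z' s) has_vector_derivative F (z s) - F (z' s)) (at s within {0..})"
      by (intro derivative_intros z z' s)
    from has_vector_derivative_mult[OF e has_vector_derivative_inner[OF this this]]
    show "(d has_vector_derivative d' s) (at s within {0..})"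
      unfolding d_def d'_def
      by (rule has_vector_derivative_eq_rhs) (simp add: algebra_simps inner_commute)
  next
    fix s :: real
    have "(F (z s) - F (z' s)) \<bullet> (z s - z' s) \<le> norm (F (z s) - F (z' s)) * norm (z s - z' s)"
      by (rule norm_cauchy_schwarz)
    also have "\<dots> \<le> L * norm (z s - z' s) * norm (z s - z' s)"
      using lipschitz_on_normD[OF L] by (intro mult_right_mono) auto
    also have "\<dots> = L * ((z s - z' s) \<bullet> (z s - z' s))"
      by (simp add: power2_norm_eq_inner[symmetric] power2_eq_square)
    finally show "d' s \<le> 0"
      by (simp add: d'_def mult_nonneg_nonpos)
  qed (use \<open>t \<ge> 0\<close> in auto)
  then have "exp (- 2 * L * t) * ((z t - z' t) \<bullet> (z t - z' t)) \<le> 0"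
    by (simp add: d_def init)
  then have "(z t - z' t) \<bullet> (z t - z' t) \<le> 0"
    by (simp add: mult_le_0_iff)
  then show ?thesis
    by (metis eq_iff_diff_eq_0 inner_gt_zero_iff not_le)
qed

lemma lipschitz_ode_exists:
  fixes F :: "'a::banach \<Rightarrow> 'a"
  assumes L: "L-lipschitz_on UNIV F"
  obtains z where "z 0 = z\<^sub>0"
    "\<And>t. t \<ge> 0 \<Longrightarrow> (z has_vector_derivative F (z t)) (at t within {0..})"
proof -
  \<comment> \<open>Writing the unknown as \<open>exp (M * t) *\<^sub>R u t\<close> with \<open>u\<close> bounded makes the Picard operator
    contract by the factor \<open>L / M\<close> on the whole half line.\<close>
  define M where "M = 2 * L + 1"
  have "L \<ge> 0" using L by (rule lipschitz_on_nonneg)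
  then have "M > 0" by (simp add: M_def)
  define G where "G u s = F (exp (M * s) *\<^sub>R apply_bcontfun u s)" for u s
  define I where "I u t = integral {0..t} (G u)" for u t
  define T where "T u t = exp (- M * t) *\<^sub>R (z\<^sub>0 + I u t)" for u t
  have contF: "continuous_on S F" for S
    using L lipschitz_on_continuous_on lipschitz_on_subset by blast
  have contG: "continuous_on S (G u)" for S u
    unfolding G_def by (intro continuous_on_compose2[OF contF[of UNIV]] continuous_intros) auto
  have derI: "(I u has_vector_derivative G u t) (at t within {0..})" if "t \<ge> 0" for u t
  proof -
    \<comment> \<open>The interval reaches past t so that, near t, it agrees with the half
      line.\<close>
    have "(I u has_vector_derivative G u t) (at t within {0..t+1})"
      unfolding I_def by (intro integral_has_vector_derivative contG) (use that in auto)
    also have "at t within {0..t+1} = at t within {0..}"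
      by (rule at_within_nhd[of _ "{..<t+1}"]) auto
    finally show ?thesis .
  qed
  \<comment> \<open>Integrating C exp(Ms) gains the factor 1/M, and the prefactor exp(-Mt) makes the
    estimate uniform in t. It serves twice: for the boundedness of \<open>T u\<close> and for the
    contraction.\<close>
  have bound: "norm (exp (- M * t) *\<^sub>R integral {0..t} g) \<le> C / M"
    if "t \<ge> 0" "C \<ge> 0" "continuous_on {0..t} g"
      and g: "\<And>s. s \<in> {0..t} \<Longrightarrow> norm (g s) \<le> C * exp (M * s)" for t C and g :: "real \<Rightarrow> 'a"
  proof -
    have "((\<lambda>s. C * exp (M * s)) has_integral C * exp (M * t) / M - C * exp (M * 0) / M) {0..t}"
      using \<open>t \<ge> 0\<close> \<open>M > 0\<close>
      by (intro fundamental_theorem_of_calculus)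
         (auto simp: has_real_derivative_iff_has_vector_derivative[symmetric]
               intro!: derivative_eq_intros)
    then have "norm (integral {0..t} g) \<le> C * exp (M * t) / M - C * exp (M * 0) / M"
      using integral_norm_bound_integral[of g "{0..t}" "\<lambda>s. C * exp (M * s)"] that
      by (metis has_integral_integrable_integral integrable_continuous_real)
    also have "\<dots> \<le> C * exp (M * t) / M" using \<open>C \<ge> 0\<close> \<open>M > 0\<close> by simp
    finally have "exp (- M * t) * norm (integral {0..t} g) \<le> exp (- M * t) * (C * exp (M * t) / M)"
      by (intro mult_left_mono) auto
    also have "\<dots> = C / M" by (simp add: exp_minus field_simps)
    finally show ?thesis by simp
  qed
  have contT: "continuous_on {0..} (T u)" for u
  proof -
    have "continuous_on {0..} (I u)"
      using derI has_vector_derivative_continuous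
      by (force simp: continuous_on_eq_continuous_within)
    then show ?thesis unfolding T_def by (intro continuous_intros)
  qed
  \<comment> \<open>Bounded continuous functions live on all of the reals here, so the image is
    continued to negative times by its value at 0.\<close>
  have TB: "(\<lambda>t. T u (max 0 t)) \<in> bcontfun" for u
  proof -
    have "continuous_on UNIV (\<lambda>t. T u (max 0 t))"
      by (rule continuous_on_compose2[OF contT]) (auto intro!: continuous_intros)
    moreover obtain B where B: "norm (apply_bcontfun u s) \<le> B" for s
      using bounded_apply_bcontfun[of u] by (auto simp: bounded_iff)
    have "B \<ge> 0" using B[of 0] norm_ge_zero order_trans by blast
    define C where "C = norm (F 0) + L * B"
    have "C \<ge> 0" using \<open>B \<ge> 0\<close> \<open>L \<ge> 0\<close> by (simp add: C_def)
    have "norm (T u (max 0 t)) \<le> norm z\<^sub>0 + C / M" for t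
    proof -
      have "norm (G u s) \<le> C * exp (M * s)" if "s \<ge> 0" for s
      proof -
        have "norm (G u s) \<le> norm (F 0) + norm (G u s - F 0)" by norm
        also have "norm (G u s - F 0) \<le> L * norm (exp (M * s) *\<^sub>R apply_bcontfun u s)"
          using lipschitz_on_normD[OF L, of "exp (M * s) *\<^sub>R apply_bcontfun u s" 0]
          by (simp add: G_def)
        also have "\<dots> \<le> L * (exp (M * s) * B)"
          using B[of s] \<open>L \<ge> 0\<close> by (intro mult_left_mono) auto
        also have "norm (F 0) + \<dots> \<le> norm (F 0) * exp (M * s) + L * (exp (M * s) * B)"
          using \<open>M > 0\<close> that by (simp add: mult_le_cancel_left1)
        finally show ?thesis by (simp add: C_def algebra_simps)
      qed
      then have "norm (exp (- M * max 0 t) *\<^sub>R I u (max 0 t)) \<le> C / M"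
        unfolding I_def by (intro bound contG \<open>C \<ge> 0\<close>) auto
      moreover have "norm (exp (- M * max 0 t) *\<^sub>R z\<^sub>0) \<le> norm z\<^sub>0"
        using \<open>M > 0\<close> by (simp add: mult_left_le_one_le)
      ultimately show ?thesis
        unfolding T_def scaleR_add_right by (intro norm_triangle_le add_mono)
    qed
    then have "bounded (range (\<lambda>t. T u (max 0 t)))"
      by (auto simp: bounded_iff)
    ultimately show ?thesis by (simp add: bcontfun_def)
  qed
  have "\<exists>!u. Bcontfun (\<lambda>t. T u (max 0 t)) = u"
  proof (rule banach_fix_type)
    show "0 \<le> L / M" "L / M < 1" using \<open>L \<ge> 0\<close> by (auto simp: M_def field_simps)
    show "\<forall>u u'. dist (Bcontfun (\<lambda>t. T u (max 0 t))) (Bcontfun (\<lambda>t. T u' (max 0 t))) \<le> L / M * dist u u'"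
    proof (intro allI dist_bound)
      fix u u' :: "real \<Rightarrow>\<^sub>C 'a" and t :: real
      let ?t = "max 0 t"
      have "norm (exp (- M * ?t) *\<^sub>R integral {0..?t} (\<lambda>s. G u s - G u' s)) \<le> (L * dist u u') / M"
      proof (rule bound)
        fix s :: real
        have "norm (G u s - G u' s)
            \<le> L * norm (exp (M * s) *\<^sub>R apply_bcontfun u s - exp (M * s) *\<^sub>R apply_bcontfun u' s)"
          unfolding G_def using lipschitz_on_normD[OF L] by simp
        also have "\<dots> = L * (exp (M * s) * dist (apply_bcontfun u s) (apply_bcontfun u' s))"
          unfolding scaleR_diff_right[symmetric] by (simp add: dist_norm)
        also have "\<dots> \<le> L * (exp (M * s) * dist u u')"
          using \<open>L \<ge> 0\<close> by (intro mult_left_mono dist_bounded) auto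
        finally show "norm (G u s - G u' s) \<le> L * dist u u' * exp (M * s)"
          by (simp add: algebra_simps)
      qed (use \<open>L \<ge> 0\<close> in \<open>auto intro!: continuous_intros contG\<close>)
      moreover have "T u ?t - T u' ?t = exp (- M * ?t) *\<^sub>R integral {0..?t} (\<lambda>s. G u s - G u' s)"
        unfolding T_def I_def
        by (subst integral_diff) (auto intro!: integrable_continuous_real contG simp: algebra_simps)
      ultimately show "dist (apply_bcontfun (Bcontfun (\<lambda>t. T u (max 0 t))) t)
          (apply_bcontfun (Bcontfun (\<lambda>t. T u' (max 0 t))) t) \<le> L / M * dist u u'"
        by (simp add: Bcontfun_inverse TB dist_norm)
    qed
  qed
  then obtain u where u: "Bcontfun (\<lambda>t. T u (max 0 t)) = u" by blast
  have uT: "apply_bcontfun u t = T u t" if "t \<ge> 0" for t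
    using arg_cong[OF u, of "\<lambda>f. apply_bcontfun f t"] that by (simp add: Bcontfun_inverse TB)
  show ?thesis
  proof (rule that[of "\<lambda>t. z\<^sub>0 + I u t"])
    fix t :: real assume t: "t \<ge> 0"
    \<comment> \<open>The fixed-point identity says exp(Mt) \<open>u\<close> t =
      \<open>z\<^sub>0 + I u t\<close>, which undoes the exponential weight.\<close>
    have "G u t = F (z\<^sub>0 + I u t)"
      unfolding G_def uT[OF t] T_def by (simp add: exp_minus)
    then show "((\<lambda>t. z\<^sub>0 + I u t) has_vector_derivative F (z\<^sub>0 + I u t)) (at t within {0..})"
      using derI[OF t, of u] by (auto intro!: derivative_eq_intros)
  qed (simp add: I_def)
qed

subsection \<open>Damped oscillators\<close>

text \<open>f decreases to its infimum l. If g were at least e at a late time t, uniform continuity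
  would keep it above e/2 on an interval of length d/2, and f would drop by e/2 * d/2. Since f is
  already within that amount of l, it would fall below l.\<close>

lemma barbalat:
  fixes f :: "real \<Rightarrow> real"
  assumes der: "\<And>t. t \<ge> 0 \<Longrightarrow> (f has_vector_derivative - g t) (at t within {0..})"
    and nonneg: "\<And>t. t \<ge> 0 \<Longrightarrow> g t \<ge> 0"
    and lower: "\<And>t. t \<ge> 0 \<Longrightarrow> B \<le> f t"
    and unif: "uniformly_continuous_on {0..} g"
  shows "(g \<longlongrightarrow> 0) at_top"
proof (rule tendstoI)
  fix e :: real assume "e > 0"
  then obtain d where "d > 0"
    and d: "\<And>s t. s \<in> {0..} \<Longrightarrow> t \<in> {0..} \<Longrightarrow> dist s t < d \<Longrightarrow> dist (g s) (g t) < e / 2"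
    using unif unfolding uniformly_continuous_on_def by (meson half_gt_zero)
  define l where "l = Inf (f ` {0..})"
  have bdd: "bdd_below (f ` {0..})"
    using lower by (auto intro!: bdd_belowI2)
  have "\<exists>x\<in>f ` {0..}. x < l + e / 2 * (d / 2)"
    unfolding l_def using \<open>e > 0\<close> \<open>d > 0\<close> by (intro cInf_lessD) auto
  then obtain T where T: "T \<ge> 0" "f T < l + e / 2 * (d / 2)" by auto
  have "g t < e" if "t \<ge> T" for t
  proof (rule ccontr)
    assume "\<not> g t < e"
    let ?b = "t + d / 2"
    have "f ?b + e / 2 * ?b \<le> f t + e / 2 * t"
    proof (rule nonincreasing_on_half_line
        [where f = "\<lambda>s. f s + e / 2 * s" and f' = "\<lambda>s. - g s + e / 2"])
      fix s assume "t < s" "s < ?b"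
      then have "dist (g t) (g s) < e / 2"
        using that T by (intro d) (auto simp: dist_real_def)
      then show "- g s + e / 2 \<le> 0"
        using \<open>\<not> g t < e\<close> unfolding dist_real_def by linarith
    next
      fix s :: real assume "s \<ge> 0"
      have "((\<lambda>s. e / 2 * s) has_vector_derivative e / 2) (at s within {0..})"
        unfolding has_real_derivative_iff_has_vector_derivative[symmetric]
        by (auto intro!: derivative_eq_intros)
      with der[OF \<open>s \<ge> 0\<close>]
      show "((\<lambda>s. f s + e / 2 * s) has_vector_derivative - g s + e / 2) (at s within {0..})"
        by (rule has_vector_derivative_add)
    qed (use that T \<open>d > 0\<close> in auto)
    moreover have "f t \<le> f T"
      using that T nonneg by (intro nonincreasing_on_half_line[OF der]) auto
    moreover have "l \<le> f ?b"
      unfolding l_def using that T \<open>d > 0\<close> by (intro cInf_lower bdd) auto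
    ultimately show False using T by (simp add: algebra_simps)
  qed
  then show "eventually (\<lambda>t. dist (g t) 0 < e) at_top"
    using nonneg T by (auto simp: eventually_at_top_linorder intro!: exI[of _ T])
qed

lemma bounded_vector_derivative_imp_lipschitz:
  fixes f :: "real \<Rightarrow> 'a::real_normed_vector"
  assumes "\<And>t. t \<in> S \<Longrightarrow> (f has_vector_derivative f' t) (at t within S)"
    and "convex S" "\<And>t. t \<in> S \<Longrightarrow> norm (f' t) \<le> C" "C \<ge> 0"
  shows "C-lipschitz_on S f"
proof (rule bounded_derivative_imp_lipschitz)
  fix t assume "t \<in> S"
  show "onorm (\<lambda>h. h *\<^sub>R f' t) \<le> C"
    using assms(3)[OF \<open>t \<in> S\<close>] by (intro onorm_le) (simp add: mult.commute[of C] mult_left_mono)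
qed (use assms in \<open>auto simp: has_vector_derivative_def\<close>)

text \<open>Once the speed is below c = e/(s+1), a window of length s allows a displacement of at
  most cs < e. The denominator s+1 also admits s = 0.\<close>

lemma increment_tendsto_zero:
  fixes f :: "real \<Rightarrow> 'a::real_normed_vector"
  assumes der: "\<And>t. t \<ge> 0 \<Longrightarrow> (f has_vector_derivative f' t) (at t within {0..})"
    and lim: "(f' \<longlongrightarrow> 0) at_top" and "s \<ge> 0"
  shows "((\<lambda>t. f (t + s) - f t) \<longlongrightarrow> 0) at_top"
proof (rule tendstoI)
  fix e :: real assume "e > 0"
  define c where "c = e / (s + 1)"
  have "c > 0" using \<open>e > 0\<close> \<open>s \<ge> 0\<close> by (simp add: c_def)
  then have "eventually (\<lambda>t. norm (f' t) < c) at_top"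
    using tendstoD[OF lim, of c] by simp
  then obtain T where T: "\<And>t. t \<ge> T \<Longrightarrow> norm (f' t) < c"
    by (auto simp: eventually_at_top_linorder)
  have lip: "c-lipschitz_on {max 0 T..} f"
    by (rule bounded_vector_derivative_imp_lipschitz[where f' = f'])
       (use T \<open>c > 0\<close> in \<open>auto intro: less_imp_le has_vector_derivative_within_subset[OF der]\<close>)
  have "c * s < e"
    using \<open>e > 0\<close> \<open>s \<ge> 0\<close> by (simp add: c_def field_simps)
  then have "dist (f (t + s) - f t) 0 < e" if "t \<ge> max 0 T" for t
    using lipschitz_on_normD[OF lip, of "t + s" t] that \<open>s \<ge> 0\<close> by auto
  then show "eventually (\<lambda>t. dist (f (t + s) - f t) 0 < e) at_top"
    unfolding eventually_at_top_linorder by blast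
qed

text \<open>The force \<open>D\<close> is kept abstract, with only the sign of its power prescribed,
  so that the same estimates serve the true drag and the truncated drag.\<close>

locale damped_oscillator =
  fixes y w D :: "real \<Rightarrow> 'a::euclidean_space"
  assumes y: "\<And>t. t \<ge> 0 \<Longrightarrow> (y has_vector_derivative w t) (at t within {0..})"
    and w: "\<And>t. t \<ge> 0 \<Longrightarrow> (w has_vector_derivative - D t - y t) (at t within {0..})"
    and dissipative: "\<And>t. t \<ge> 0 \<Longrightarrow> D t \<bullet> w t \<ge> 0"
begin

definition energy :: "real \<Rightarrow> real" where
  "energy t = y t \<bullet> y t + w t \<bullet> w t"

lemma energy_derivative:
  assumes "t \<ge> 0"
  shows "(energy has_vector_derivative - (2 * (D t \<bullet> w t))) (at t within {0..})"
proof -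
  from has_vector_derivative_add[OF has_vector_derivative_inner[OF y y] has_vector_derivative_inner[OF w w],
      OF assms assms assms assms]
  show ?thesis
    unfolding energy_def [abs_def]
    by (rule has_vector_derivative_eq_rhs) (simp add: inner_diff_left inner_diff_right inner_commute)
qed

lemma energy_mono:
  assumes "0 \<le> a" "a \<le> b"
  shows "energy b \<le> energy a"
  by (rule nonincreasing_on_half_line[OF energy_derivative]) (use assms dissipative in auto)

lemma norm_le_sqrt_energy:
  assumes "t \<ge> 0"
  shows "norm (y t) \<le> sqrt (energy 0)" "norm (w t) \<le> sqrt (energy 0)"
proof -
  have "(norm (y t))\<^sup>2 + (norm (w t))\<^sup>2 \<le> energy 0"
    using energy_mono[of 0 t] assms by (simp add: energy_def power2_norm_eq_inner)
  then have "(norm (y t))\<^sup>2 \<le> energy 0" "(norm (w t))\<^sup>2 \<le> energy 0"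
    by (smt (verit) zero_le_power2)+
  then show "norm (y t) \<le> sqrt (energy 0)" "norm (w t) \<le> sqrt (energy 0)"
    by (auto intro: real_le_rsqrt)
qed

text \<open>The derivative is -2 (e \<bullet> D)(e \<bullet> w). If D is a nonnegative multiple of w
  at each time, the hypothesis holds for every e, which gives far more than monotonicity of the
  total energy.\<close>

lemma projected_energy_mono:
  assumes "\<And>t. t \<ge> 0 \<Longrightarrow> (e \<bullet> D t) * (e \<bullet> w t) \<ge> 0" and "0 \<le> a" "a \<le> b"
  shows "(e \<bullet> y b)\<^sup>2 + (e \<bullet> w b)\<^sup>2 \<le> (e \<bullet> y a)\<^sup>2 + (e \<bullet> w a)\<^sup>2"
proof -
  have p: "((\<lambda>t. e \<bullet> y t) has_vector_derivative e \<bullet> w t) (at t within {0..})"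
     "((\<lambda>t. e \<bullet> w t) has_vector_derivative e \<bullet> (- D t - y t)) (at t within {0..})" if "t \<ge> 0" for t
    using has_vector_derivative_inner[OF has_vector_derivative_const y[OF that], of e]
      has_vector_derivative_inner[OF has_vector_derivative_const w[OF that], of e] by simp_all
  have "((\<lambda>t. (e \<bullet> y t)\<^sup>2 + (e \<bullet> w t)\<^sup>2) has_vector_derivative - (2 * ((e \<bullet> D t) * (e \<bullet> w t))))
      (at t within {0..})" if "t \<ge> 0" for t
    using has_vector_derivative_add[OF has_vector_derivative_mult[OF p(1) p(1)]
        has_vector_derivative_mult[OF p(2) p(2)], OF that that that that]
    unfolding power2_eq_square
    by (rule has_vector_derivative_eq_rhs) (simp add: algebra_simps)
  from nonincreasing_on_half_line[OF this] show ?thesis using assms by auto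
qed

text \<open>In a frame rotating with the free oscillation only the force \<open>D\<close> moves the
  state. As \<open>D\<close> tends to 0, the state in this frame is almost constant over a window of
  fixed length s, and rotating back gives the free oscillation started at (Y, W).\<close>

lemma limit_along_periods:
  assumes D: "(D \<longlongrightarrow> 0) at_top" and "s \<ge> 0"
    and r: "strict_mono (r :: nat \<Rightarrow> nat)"
    and Y: "(\<lambda>k. y (real (r k) * (2 * pi))) \<longlonglongrightarrow> Y"
    and W: "(\<lambda>k. w (real (r k) * (2 * pi))) \<longlonglongrightarrow> W"
  shows "(\<lambda>k. y (real (r k) * (2 * pi) + s)) \<longlonglongrightarrow> cos s *\<^sub>R Y + sin s *\<^sub>R W"
    and "(\<lambda>k. w (real (r k) * (2 * pi) + s)) \<longlonglongrightarrow> cos s *\<^sub>R W - sin s *\<^sub>R Y"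
proof -
  \<comment> \<open>\<open>p t\<close> and \<open>q t\<close> are the position and velocity at time
    0 of the free oscillation that passes through (\<open>y t\<close>, \<open>w t\<close>) at time
    t. At multiples of 2 pi they coincide with \<open>y\<close> and \<open>w\<close>.\<close>
  define p where "p t = cos t *\<^sub>R y t - sin t *\<^sub>R w t" for t
  define q where "q t = sin t *\<^sub>R y t + cos t *\<^sub>R w t" for t
  let ?t = "\<lambda>k. real (r k) * (2 * pi)"
  have trig: "cos (?t k + s) = cos s" "sin (?t k + s) = sin s" "cos (?t k) = 1" "sin (?t k) = 0" for k
    using sin_2npi[of "r k"] cos_2npi[of "r k"]
    by (simp_all add: cos_add sin_add mult.commute mult.left_commute)
  have sincos: "(sin has_real_derivative cos t) (at t within S)"
    "(cos has_real_derivative - sin t) (at t within S)" for t :: real and S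
    by (auto intro!: derivative_eq_intros)
  have dp: "(p has_vector_derivative sin t *\<^sub>R D t) (at t within {0..})"
    and dq: "(q has_vector_derivative - cos t *\<^sub>R D t) (at t within {0..})" if "t \<ge> 0" for t
    unfolding p_def q_def
    by (rule has_vector_derivative_eq_rhs, (rule derivative_intros sincos y w that)+,
        simp add: algebra_simps)+
  have "((\<lambda>t. sin t *\<^sub>R D t) \<longlongrightarrow> 0) at_top" "((\<lambda>t. - cos t *\<^sub>R D t) \<longlongrightarrow> 0) at_top"
    by (rule Lim_null_comparison[OF _ tendsto_norm_zero[OF D]];
        simp add: mult_left_le_one_le)+
  from increment_tendsto_zero[OF dp this(1) \<open>s \<ge> 0\<close>] increment_tendsto_zero[OF dq this(2) \<open>s \<ge> 0\<close>]
  have inc: "((\<lambda>t. p (t + s) - p t) \<longlongrightarrow> 0) at_top" "((\<lambda>t. q (t + s) - q t) \<longlongrightarrow> 0) at_top"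
    by blast+
  have t: "filterlim ?t at_top sequentially"
    by (intro filterlim_at_top_mult_tendsto_pos[OF tendsto_const]
        filterlim_compose[OF filterlim_real_sequentially] filterlim_subseq r) simp
  have P: "(\<lambda>k. p (?t k + s)) \<longlonglongrightarrow> Y"
    using tendsto_add[OF filterlim_compose[OF inc(1) t] Y] by (simp add: p_def trig)
  have Q: "(\<lambda>k. q (?t k + s)) \<longlonglongrightarrow> W"
    using tendsto_add[OF filterlim_compose[OF inc(2) t] W] by (simp add: q_def trig)
  have yw: "y t = cos t *\<^sub>R p t + sin t *\<^sub>R q t" "w t = cos t *\<^sub>R q t - sin t *\<^sub>R p t" for t
  proof -
    have "cos t *\<^sub>R p t + sin t *\<^sub>R q t = ((sin t)\<^sup>2 + (cos t)\<^sup>2) *\<^sub>R y t"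
      "cos t *\<^sub>R q t - sin t *\<^sub>R p t = ((sin t)\<^sup>2 + (cos t)\<^sup>2) *\<^sub>R w t"
      unfolding p_def q_def power2_eq_square
      by (simp_all add: algebra_simps del: sin_cos_squared_add3)
    then show "y t = cos t *\<^sub>R p t + sin t *\<^sub>R q t" "w t = cos t *\<^sub>R q t - sin t *\<^sub>R p t"
      by simp_all
  qed
  show "(\<lambda>k. y (?t k + s)) \<longlonglongrightarrow> cos s *\<^sub>R Y + sin s *\<^sub>R W"
    and "(\<lambda>k. w (?t k + s)) \<longlonglongrightarrow> cos s *\<^sub>R W - sin s *\<^sub>R Y"
    unfolding yw[of "?t _ + s"] trig by (intro tendsto_intros P Q)+
qed

end

text \<open>Half a period reverses the sign, so the intermediate value theorem applies on [0, pi].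
  This provides the phase at which a free oscillation is orthogonal to a given vector.\<close>

lemma exists_cos_sin_zero:
  fixes a b :: real
  obtains s where "s \<ge> 0" "cos s * a + sin s * b = 0"
proof -
  define f where "f s = cos s * a + sin s * b" for s
  have cont: "continuous_on {0..pi} f" unfolding f_def by (intro continuous_intros)
  have "f 0 = a" "f pi = - a" by (simp_all add: f_def)
  then have "\<exists>s. 0 \<le> s \<and> s \<le> pi \<and> f s = 0"
    using IVT'[of f 0 0 pi] IVT2'[of f pi 0 0] cont pi_ge_zero
    by (cases "a \<ge> 0") auto
  then show ?thesis using that by (auto simp: f_def)
qed

subsection \<open>Relative motion\<close>

lemma lipschitz_on_scaleR:
  fixes f :: "'a::metric_space \<Rightarrow> real" and g :: "'a \<Rightarrow> 'b::real_normed_vector"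
  assumes f: "L-lipschitz_on S f" and g: "M-lipschitz_on S g"
    and A: "\<And>x. x \<in> S \<Longrightarrow> \<bar>f x\<bar> \<le> A" and B: "\<And>x. x \<in> S \<Longrightarrow> norm (g x) \<le> B"
    and "A \<ge> 0" "B \<ge> 0"
  shows "(L * B + A * M)-lipschitz_on S (\<lambda>x. f x *\<^sub>R g x)"
proof (rule lipschitz_onI)
  have "L \<ge> 0" "M \<ge> 0" using f g by (auto dest: lipschitz_on_nonneg)
  then show "L * B + A * M \<ge> 0" using \<open>A \<ge> 0\<close> \<open>B \<ge> 0\<close> by simp
  fix x x' assume x: "x \<in> S" "x' \<in> S"
  have "f x *\<^sub>R g x - f x' *\<^sub>R g x' = (f x - f x') *\<^sub>R g x + f x' *\<^sub>R (g x - g x')"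
    by (simp add: algebra_simps)
  then have "dist (f x *\<^sub>R g x) (f x' *\<^sub>R g x') \<le> dist (f x) (f x') * norm (g x) + \<bar>f x'\<bar> * dist (g x) (g x')"
    by (metis dist_norm norm_triangle_ineq norm_scaleR real_norm_def)
  also have "\<dots> \<le> (L * dist x x') * B + A * (M * dist x x')"
    using lipschitz_onD[OF f x] lipschitz_onD[OF g x] A B x \<open>A \<ge> 0\<close> \<open>L \<ge> 0\<close>
    by (intro add_mono mult_mono) auto
  finally show "dist (f x *\<^sub>R g x) (f x' *\<^sub>R g x') \<le> (L * B + A * M) * dist x x'"
    by (simp add: algebra_simps)
qed

text \<open>The partial derivatives are bounded on the compact ball. Outside it, f attains its
  minimum value 0, so the derivative vanishes there.\<close>

lemma C_1_vanishing_outside_ball_imp_lipschitz: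
  fixes f :: "'a::euclidean_space \<Rightarrow> real"
  assumes C1: "C_k 1 f" and nonneg: "\<And>x. f x \<ge> 0" and zero: "\<And>x. norm x \<ge> r \<Longrightarrow> f x = 0"
  obtains L where "L-lipschitz_on UNIV f"
proof -
  let ?D = "\<lambda>x. frechet_derivative f (at x)"
  have der: "(f has_derivative ?D x) (at x)" for x
    using C1 by (simp add: differentiable_on_def frechet_derivative_works)
  have "\<exists>B. \<forall>x\<in>cball 0 r. \<bar>?D x b\<bar> \<le> B" if "b \<in> Basis" for b
  proof -
    have "continuous_on (cball 0 r) (\<lambda>x. ?D x b)"
      using C1 that by (auto intro: continuous_on_subset)
    then have "bounded ((\<lambda>x. ?D x b) ` cball 0 r)"
      by (intro compact_imp_bounded compact_continuous_image) auto
    then show ?thesis by (auto simp: bounded_iff)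
  qed
  then obtain B where B: "\<And>b x. b \<in> Basis \<Longrightarrow> norm x \<le> r \<Longrightarrow> \<bar>?D x b\<bar> \<le> B b"
    by (metis mem_cball_0)
  define L where "L = (\<Sum>b\<in>Basis. \<bar>B b\<bar>)"
  have "L \<ge> 0" by (simp add: L_def sum_nonneg)
  have "onorm (?D x) \<le> L" for x
  proof (cases "norm x \<le> r")
    case True
    have "onorm (?D x) \<le> (\<Sum>b\<in>Basis. norm (?D x b))"
      by (rule onorm_componentwise) (rule has_derivative_bounded_linear[OF der])
    also have "\<dots> \<le> L"
      unfolding L_def using B[OF _ True] by (intro sum_mono) (force intro: order_trans)
    finally show ?thesis .
  next
    case False
    then have "?D x = (\<lambda>v. 0)"
      using zero nonneg by (intro differential_zero_maxmin[OF _ open_UNIV der]) auto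
    then show ?thesis using \<open>L \<ge> 0\<close> by (simp add: onorm_zero)
  qed
  then have "norm (f x - f y) \<le> L * norm (x - y)" for x y
    by (intro differentiable_bound[OF convex_UNIV]) (auto intro: der)
  then have "L-lipschitz_on UNIV f"
    using \<open>L \<ge> 0\<close> by (intro lipschitz_onI) (auto simp: dist_norm)
  then show ?thesis by (rule that)
qed

section \<open>Well-posedness of the relative equation\<close>

locale alignment_kernel =
  fixes \<phi> :: "'a::euclidean_space \<Rightarrow> real" and r\<^sub>0 :: real
  assumes r0: "r\<^sub>0 > 0"
    and nonneg: "\<And>x. \<phi> x \<ge> 0"
    and smooth: "smooth \<phi>"
    and decreasing: "radially_decreasing \<phi>"
    and positive: "\<And>x. norm x < r\<^sub>0 \<Longrightarrow> \<phi> x > 0"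
    and zero: "\<And>x. norm x \<ge> r\<^sub>0 \<Longrightarrow> \<phi> x = 0"
begin

lemma even: "\<phi> (- x) = \<phi> x"
  using decreasing by (intro antisym) (auto simp: radially_decreasing_def)

lemma le_zero: "\<phi> x \<le> \<phi> 0"
  using decreasing by (auto simp: radially_decreasing_def)

lemma lipschitz: obtains L where "L-lipschitz_on UNIV \<phi>"
proof (rule C_1_vanishing_outside_ball_imp_lipschitz)
  show "C_k 1 \<phi>" using smooth unfolding smooth_def by blast
qed (use nonneg zero in auto)

definition relative_solution :: "(real \<Rightarrow> 'a) \<Rightarrow> (real \<Rightarrow> 'a) \<Rightarrow> bool" where
  "relative_solution y w \<longleftrightarrow> (\<forall>t\<ge>0.
     (y has_vector_derivative w t) (at t within {0..}) \<and>
     (w has_vector_derivative - (\<phi> (y t) *\<^sub>R w t) - y t) (at t within {0..}))"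

text \<open>Cutting off the velocity makes the field globally Lipschitz; the cutoff is inactive on
  solutions whose initial energy is at most \<open>R\<^sup>2\<close>, because the truncated drag still dissipates.\<close>

definition truncated_field :: "real \<Rightarrow> 'a \<times> 'a \<Rightarrow> 'a \<times> 'a" where
  "truncated_field R z =
     (snd z, - (\<phi> (fst z) *\<^sub>R closest_point (cball 0 R) (snd z)) - fst z)"

text \<open>The variation of \<phi>(y) w in y grows with |w|. After projecting w to the ball, both
  factors are bounded and Lipschitz, and so is their product.\<close>

lemma truncated_field_lipschitz:
  assumes "R \<ge> 0"
  obtains L where "L-lipschitz_on UNIV (truncated_field R)"
proof -
  let ?P = "closest_point (cball (0::'a) R)"
  obtain L where L: "L-lipschitz_on UNIV \<phi>" by (rule lipschitz)
  have fst: "1-lipschitz_on UNIV (fst :: 'a \<times> 'a \<Rightarrow> 'a)"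
    and snd: "1-lipschitz_on UNIV (snd :: 'a \<times> 'a \<Rightarrow> 'a)"
    by (intro lipschitz_onI; simp add: dist_fst_le dist_snd_le)+
  have P: "1-lipschitz_on UNIV ?P"
    using \<open>R \<ge> 0\<close> by (intro lipschitz_onI) (auto intro: closest_point_lipschitz)
  have "norm (?P b) \<le> R" for b
    using closest_point_in_set[of "cball 0 R" b] \<open>R \<ge> 0\<close> by auto
  then have "(L * 1 * R + \<phi> 0 * (1 * 1))-lipschitz_on UNIV
      (\<lambda>z. \<phi> (fst z) *\<^sub>R ?P (snd z))"
    using \<open>R \<ge> 0\<close> nonneg le_zero
    by (intro lipschitz_on_scaleR lipschitz_on_compose2[of _ _ "fst"] lipschitz_on_compose2[of _ _ "snd"])
       (auto intro: fst snd lipschitz_on_subset[OF L] lipschitz_on_subset[OF P])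
  from lipschitz_on_Pair[OF snd lipschitz_on_diff[OF lipschitz_on_minus[OF this] fst]]
  show ?thesis using that unfolding truncated_field_def[abs_def] by blast
qed

lemma damped_oscillator_truncated:
  assumes "R \<ge> 0"
    and z: "\<And>t. t \<ge> 0 \<Longrightarrow> (z has_vector_derivative truncated_field R (z t)) (at t within {0..})"
  shows "damped_oscillator (\<lambda>t. fst (z t)) (\<lambda>t. snd (z t))
    (\<lambda>t. \<phi> (fst (z t)) *\<^sub>R closest_point (cball 0 R) (snd (z t)))"
proof
  fix t :: real assume t: "t \<ge> 0"
  show "((\<lambda>t. fst (z t)) has_vector_derivative snd (z t)) (at t within {0..})"
    using bounded_linear.has_vector_derivative[OF bounded_linear_fst z[OF t]]
    by (simp add: truncated_field_def)
  show "((\<lambda>t. snd (z t)) has_vector_derivative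
      - (\<phi> (fst (z t)) *\<^sub>R closest_point (cball 0 R) (snd (z t))) - fst (z t)) (at t within {0..})"
    using bounded_linear.has_vector_derivative[OF bounded_linear_snd z[OF t]]
    by (simp add: truncated_field_def)
  let ?c = "closest_point (cball 0 R) (snd (z t))"
  \<comment> \<open>The variational inequality of the projection, tested with the centre of the
    ball; it shows that projecting does not reverse the sign of the power.\<close>
  have "(snd (z t) - ?c) \<bullet> (0 - ?c) \<le> 0"
    using \<open>R \<ge> 0\<close> by (intro closest_point_dot) auto
  then have "?c \<bullet> snd (z t) \<ge> ?c \<bullet> ?c"
    by (simp add: inner_diff_left inner_diff_right inner_commute)
  then have "?c \<bullet> snd (z t) \<ge> 0"
    using inner_ge_zero order_trans by blast
  then show "(\<phi> (fst (z t)) *\<^sub>R ?c) \<bullet> snd (z t) \<ge> 0"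
    by (simp add: nonneg)
qed

lemma relative_solution_exists:
  obtains y w where "relative_solution y w" "y 0 = y\<^sub>0" "w 0 = w\<^sub>0"
proof -
  \<comment> \<open>With this radius the energy bound gives |w| \<le> R for all times, so the
    projection acts as the identity along the orbit.\<close>
  define R where "R = sqrt (y\<^sub>0 \<bullet> y\<^sub>0 + w\<^sub>0 \<bullet> w\<^sub>0)"
  have "R \<ge> 0" by (simp add: R_def)
  then obtain L where "L-lipschitz_on UNIV (truncated_field R)" by (rule truncated_field_lipschitz)
  then obtain z where z0: "z 0 = (y\<^sub>0, w\<^sub>0)"
    and z: "\<And>t. t \<ge> 0 \<Longrightarrow> (z has_vector_derivative truncated_field R (z t)) (at t within {0..})"
    using lipschitz_ode_exists[of L _ "(y\<^sub>0, w\<^sub>0)"] by metis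
  interpret damped_oscillator "\<lambda>t. fst (z t)" "\<lambda>t. snd (z t)"
    "\<lambda>t. \<phi> (fst (z t)) *\<^sub>R closest_point (cball 0 R) (snd (z t))"
    using \<open>R \<ge> 0\<close> z by (rule damped_oscillator_truncated)
  have "closest_point (cball 0 R) (snd (z t)) = snd (z t)" if "t \<ge> 0" for t
    using norm_le_sqrt_energy(2)[OF that] by (intro closest_point_self) (simp add: energy_def z0 R_def)
  then have "relative_solution (\<lambda>t. fst (z t)) (\<lambda>t. snd (z t))"
    using y w by (simp add: relative_solution_def)
  then show ?thesis using that z0 by simp
qed

lemma damped_oscillator_relative_solution:
  assumes "relative_solution y w"
  shows "damped_oscillator y w (\<lambda>t. \<phi> (y t) *\<^sub>R w t)"
  using assms by unfold_locales (auto simp: relative_solution_def nonneg)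

text \<open>Equal initial data give equal initial energies, so both solutions solve the truncated
  equation with one and the same R, whose field is globally Lipschitz.\<close>

lemma relative_solution_unique:
  assumes sol: "relative_solution y w" "relative_solution y' w'"
    and init: "y 0 = y' 0" "w 0 = w' 0" and "t \<ge> 0"
  shows "y t = y' t" "w t = w' t"
proof -
  define R where "R = sqrt (y 0 \<bullet> y 0 + w 0 \<bullet> w 0)"
  have "R \<ge> 0" by (simp add: R_def)
  then obtain L where L: "L-lipschitz_on UNIV (truncated_field R)" by (rule truncated_field_lipschitz)
  have trunc: "((\<lambda>t. (u t, v t)) has_vector_derivative truncated_field R (u t, v t)) (at t within {0..})"
    if uv: "relative_solution u v" "u 0 = y 0" "v 0 = w 0" and t: "t \<ge> 0" for u v t
  proof -
    interpret damped_oscillator u v "\<lambda>t. \<phi> (u t) *\<^sub>R v t"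
      by (rule damped_oscillator_relative_solution) fact
    have "closest_point (cball 0 R) (v t) = v t"
      using norm_le_sqrt_energy(2)[OF t]
      by (intro closest_point_self) (simp add: energy_def uv R_def)
    then show ?thesis
      using uv(1) t unfolding truncated_field_def relative_solution_def
      by (auto intro!: has_vector_derivative_Pair)
  qed
  have "(y t, w t) = (y' t, w' t)"
    by (rule lipschitz_ode_unique[OF L trunc trunc]) (use assms in auto)
  then show "y t = y' t" "w t = w' t" by auto
qed

section \<open>Long-time behaviour of the relative motion\<close>

lemma drag_tendsto_zero:
  assumes sol: "relative_solution y w"
  shows "((\<lambda>t. \<phi> (y t) *\<^sub>R w t) \<longlongrightarrow> 0) at_top"
proof -
  interpret damped_oscillator y w "\<lambda>t. \<phi> (y t) *\<^sub>R w t"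
    by (rule damped_oscillator_relative_solution) fact
  define R where "R = sqrt (energy 0)"
  have yw: "norm (y t) \<le> R" "norm (w t) \<le> R" if "t \<ge> 0" for t
    using norm_le_sqrt_energy[OF that] by (simp_all add: R_def)
  have "R \<ge> 0" using yw(1)[of 0] norm_ge_zero order_trans by blast
  \<comment> \<open>\<open>h\<close> is the rate of energy loss as a function of the state. The
    orbit is Lipschitz in time and stays in a compact set, where \<open>h\<close> is uniformly
    continuous, so Barbalat's lemma applies to the energy.\<close>
  define h where "h z = 2 * ((\<phi> (fst z) *\<^sub>R snd z) \<bullet> snd z)" for z :: "'a \<times> 'a"
  obtain L where "L-lipschitz_on UNIV \<phi>" by (rule lipschitz)
  then have cont: "continuous_on UNIV \<phi>" by (rule lipschitz_on_continuous_on)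
  have "R-lipschitz_on {0..} y"
    by (rule bounded_vector_derivative_imp_lipschitz[OF y]) (use yw \<open>R \<ge> 0\<close> in auto)
  moreover have "(\<phi> 0 * R + R)-lipschitz_on {0..} w"
  proof (rule bounded_vector_derivative_imp_lipschitz[OF w])
    fix t :: real assume t: "t \<in> {0..}"
    have "norm (- (\<phi> (y t) *\<^sub>R w t) - y t) \<le> \<phi> (y t) * norm (w t) + norm (y t)"
      using norm_triangle_ineq4[of "- (\<phi> (y t) *\<^sub>R w t)" "y t"] by (simp add: nonneg)
    also have "\<dots> \<le> \<phi> 0 * R + R"
      using t yw[of t] by (intro add_mono mult_mono le_zero nonneg) auto
    finally show "norm (- (\<phi> (y t) *\<^sub>R w t) - y t) \<le> \<phi> 0 * R + R" .
  qed (use \<open>R \<ge> 0\<close> nonneg in auto)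
  ultimately have "uniformly_continuous_on {0..} (\<lambda>t. (y t, w t))"
    using lipschitz_on_Pair lipschitz_on_uniformly_continuous by blast
  moreover have "uniformly_continuous_on ((\<lambda>t. (y t, w t)) ` {0..}) h"
  proof -
    have "uniformly_continuous_on (cball 0 R \<times> cball 0 R) h"
      unfolding h_def
      by (intro compact_uniformly_continuous continuous_intros continuous_on_compose2[OF cont])
         (auto intro: compact_Times)
    moreover have "(\<lambda>t. (y t, w t)) ` {0..} \<subseteq> cball 0 R \<times> cball 0 R"
      using yw by auto
    ultimately show ?thesis
      unfolding uniformly_continuous_on_def by (meson subsetD)
  qed
  ultimately have "uniformly_continuous_on {0..} (\<lambda>t. h (y t, w t))"
    by (rule uniformly_continuous_on_compose)
  then have "((\<lambda>t. h (y t, w t)) \<longlongrightarrow> 0) at_top"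
    using energy_derivative dissipative
    by (intro barbalat[where f = energy and B = 0]) (auto simp: h_def energy_def)
  then have "((\<lambda>t. sqrt (\<phi> 0 / 2 * h (y t, w t))) \<longlongrightarrow> sqrt (\<phi> 0 / 2 * 0)) at_top"
    by (intro tendsto_intros)
  then have "((\<lambda>t. sqrt (\<phi> 0 / 2 * h (y t, w t))) \<longlongrightarrow> 0) at_top"
    by simp
  \<comment> \<open>The drag carries \<phi> squared but the dissipation only \<phi>; the bound by
    \<phi>(0) absorbs one factor.\<close>
  moreover have "norm (\<phi> (y t) *\<^sub>R w t) \<le> sqrt (\<phi> 0 / 2 * h (y t, w t))" for t
  proof (rule real_le_rsqrt)
    have "(norm (\<phi> (y t) *\<^sub>R w t))\<^sup>2 = \<phi> (y t) * (\<phi> (y t) * (w t \<bullet> w t))"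
      unfolding power2_norm_eq_inner by simp
    also have "\<dots> \<le> \<phi> 0 * (\<phi> (y t) * (w t \<bullet> w t))"
      by (intro mult_right_mono le_zero) (simp add: nonneg)
    finally show "(norm (\<phi> (y t) *\<^sub>R w t))\<^sup>2 \<le> \<phi> 0 / 2 * h (y t, w t)"
      by (simp add: h_def)
  qed
  ultimately show ?thesis
    by (rule Lim_null_comparison[OF always_eventually[OF allI], rotated])
qed

theorem relative_solution_tendsto_zero:
  assumes sol: "relative_solution y w" and "T \<ge> 0" and inside: "norm (y T) < r\<^sub>0"
  shows "((\<lambda>t. norm (y t) + norm (w t)) \<longlongrightarrow> 0) at_top"
proof -
  interpret damped_oscillator y w "\<lambda>t. \<phi> (y t) *\<^sub>R w t"
    by (rule damped_oscillator_relative_solution) fact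
  define R where "R = sqrt (energy 0)"
  let ?t = "\<lambda>k. real k * (2 * pi)"
  let ?f = "\<lambda>k. (y (?t k), w (?t k))"
  have "seq_compact (cball (0::'a) R \<times> cball (0::'a) R)"
    by (intro compact_imp_seq_compact compact_Times compact_cball)
  moreover have "\<forall>k. ?f k \<in> cball 0 R \<times> cball 0 R"
    using norm_le_sqrt_energy by (auto simp: R_def)
  ultimately obtain l r where r: "strict_mono (r :: nat \<Rightarrow> nat)" and "(?f \<circ> r) \<longlonglongrightarrow> l"
    by (rule seq_compactE)
  then have l: "(\<lambda>k. (y (?t (r k)), w (?t (r k)))) \<longlonglongrightarrow> l"
    by (simp add: comp_def)
  obtain Y W where "l = (Y, W)" by force
  with l have Y: "(\<lambda>k. y (?t (r k))) \<longlonglongrightarrow> Y" and W: "(\<lambda>k. w (?t (r k))) \<longlonglongrightarrow> W"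
    by (auto dest: tendsto_fst tendsto_snd)
  define Ys where "Ys s = cos s *\<^sub>R Y + sin s *\<^sub>R W" for s
  define Ws where "Ws s = cos s *\<^sub>R W - sin s *\<^sub>R Y" for s
  note lim = limit_along_periods[OF drag_tendsto_zero[OF sol] _ r Y W, folded Ys_def Ws_def]
  have t: "filterlim (\<lambda>k. ?t (r k) + s) at_top sequentially" for s
  proof -
    have "filterlim (\<lambda>k. ?t (r k)) at_top sequentially"
      by (intro filterlim_at_top_mult_tendsto_pos[OF tendsto_const]
          filterlim_compose[OF filterlim_real_sequentially] filterlim_subseq r) simp
    from filterlim_tendsto_add_at_top[OF tendsto_const[of s] this] show ?thesis
      by (simp add: add.commute)
  qed
  obtain L where "L-lipschitz_on UNIV \<phi>" by (rule lipschitz)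
  then have cont: "isCont \<phi> x" for x
    using lipschitz_on_continuous_on continuous_on_eq_continuous_at open_UNIV by blast
  \<comment> \<open>By continuity of \<phi>, the drag along the shifted times converges to the drag
    of the limit oscillation, and it also converges to 0.\<close>
  have no_drag: "\<phi> (Ys s) *\<^sub>R Ws s = 0" if "s \<ge> 0" for s
  proof (rule LIMSEQ_unique)
    show "(\<lambda>k. \<phi> (y (?t (r k) + s)) *\<^sub>R w (?t (r k) + s)) \<longlonglongrightarrow> \<phi> (Ys s) *\<^sub>R Ws s"
      by (intro tendsto_scaleR isCont_tendsto_compose[OF cont] lim that)
    show "(\<lambda>k. \<phi> (y (?t (r k) + s)) *\<^sub>R w (?t (r k) + s)) \<longlonglongrightarrow> 0"
      using filterlim_compose[OF drag_tendsto_zero[OF sol] t] .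
  qed
  obtain s where s: "s \<ge> 0" "cos s * (Y \<bullet> w T) + sin s * (W \<bullet> w T) = 0"
    by (rule exists_cos_sin_zero)
  then have orth: "Ys s \<bullet> w T = 0"
    by (simp add: Ys_def inner_add_left)
  \<comment> \<open>The energy projected to the fixed direction \<open>Ys s\<close> decreases from
    time T on; passing to the limit along the subsequence compares the limit state with the state at
    T.\<close>
  have "(Ys s \<bullet> Ys s)\<^sup>2 + (Ys s \<bullet> Ws s)\<^sup>2 \<le> (Ys s \<bullet> y T)\<^sup>2 + (Ys s \<bullet> w T)\<^sup>2"
  proof (rule tendsto_upperbound)
    show "(\<lambda>k. (Ys s \<bullet> y (?t (r k) + s))\<^sup>2 + (Ys s \<bullet> w (?t (r k) + s))\<^sup>2)
        \<longlonglongrightarrow> (Ys s \<bullet> Ys s)\<^sup>2 + (Ys s \<bullet> Ws s)\<^sup>2"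
      by (intro tendsto_intros lim s)
    have "eventually (\<lambda>k. ?t (r k) + s \<ge> T) sequentially"
      using t by (auto simp: filterlim_at_top)
    then show "eventually (\<lambda>k. (Ys s \<bullet> y (?t (r k) + s))\<^sup>2 + (Ys s \<bullet> w (?t (r k) + s))\<^sup>2
        \<le> (Ys s \<bullet> y T)\<^sup>2 + (Ys s \<bullet> w T)\<^sup>2) sequentially"
    proof eventually_elim
      case (elim k)
      show ?case
        by (rule projected_energy_mono[OF _ \<open>T \<ge> 0\<close> elim]) (simp add: nonneg mult.assoc)
    qed
  qed simp
  then have "(Ys s \<bullet> Ys s)\<^sup>2 \<le> (Ys s \<bullet> y T)\<^sup>2"
    unfolding orth by (smt (verit) zero_le_power2 power_zero_numeral)
  also have "\<dots> \<le> (Ys s \<bullet> Ys s) * (y T \<bullet> y T)"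
    by (rule Cauchy_Schwarz_ineq)
  finally have "Ys s = 0 \<or> Ys s \<bullet> Ys s \<le> y T \<bullet> y T"
    by (cases "Ys s = 0") (simp_all add: power2_eq_square mult_le_cancel_left_pos)
  then have "norm (Ys s) < r\<^sub>0"
    using inside r0 by (auto simp: norm_le[symmetric])
  then have Ws: "Ws s = 0"
    using no_drag[OF s(1)] positive by force
  \<comment> \<open>A quarter period exchanges position and velocity up to sign: the limit is then
    at the origin, where \<phi> is positive.\<close>
  have "Ys (s + pi / 2) = Ws s" "Ws (s + pi / 2) = - Ys s"
    by (simp_all add: Ys_def Ws_def cos_add sin_add)
  then have Ys: "Ys s = 0"
    using no_drag[of "s + pi / 2"] s(1) positive[of 0] r0 Ws by simp
  have "(\<lambda>k. energy (?t (r k) + s)) \<longlonglongrightarrow> Ys s \<bullet> Ys s + Ws s \<bullet> Ws s"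
    unfolding energy_def by (intro tendsto_intros lim s)
  then have E0: "(\<lambda>k. energy (?t (r k) + s)) \<longlonglongrightarrow> 0"
    by (simp add: Ys Ws)
  \<comment> \<open>Monotonicity of the energy turns convergence along the subsequence into
    convergence for all times.\<close>
  have "(energy \<longlongrightarrow> 0) at_top"
  proof (rule tendstoI)
    fix e :: real assume "e > 0"
    from tendstoD[OF E0 this] obtain k where "dist (energy (?t (r k) + s)) 0 < e"
      by (auto simp: eventually_sequentially)
    then have "dist (energy t) 0 < e" if "t \<ge> ?t (r k) + s" for t
      using energy_mono[OF _ that] s(1) by (simp add: energy_def)
    then show "eventually (\<lambda>t. dist (energy t) 0 < e) at_top"
      unfolding eventually_at_top_linorder by blast
  qed
  then have "((\<lambda>t. 2 * sqrt (energy t)) \<longlongrightarrow> 2 * sqrt 0) at_top"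
    by (intro tendsto_intros)
  then have "((\<lambda>t. 2 * sqrt (energy t)) \<longlongrightarrow> 0) at_top"
    by simp
  moreover have "norm (norm (y t) + norm (w t)) \<le> 2 * sqrt (energy t)" for t
  proof -
    have "norm (y t) \<le> sqrt (energy t)" "norm (w t) \<le> sqrt (energy t)"
      by (simp_all add: norm_eq_sqrt_inner energy_def)
    then show ?thesis by simp
  qed
  ultimately show ?thesis
    by (rule Lim_null_comparison[OF always_eventually[OF allI], rotated])
qed

end

subsection \<open>The two-agent system\<close>

text \<open>The definite description needs uniqueness as well: the derivative is unique, and a
  vector is determined by its inner products.\<close>

lemma gradient_U: "gradient U x = x"
proof -
  have "GDERIV U x :> x"
    unfolding gderiv_def U_def power2_norm_eq_inner
    by (auto intro!: derivative_eq_intros simp: inner_commute)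
  moreover have "D = x" if "GDERIV U x :> D" for D
  proof -
    have "(\<lambda>h. h \<bullet> D) = (\<lambda>h. h \<bullet> x)"
      using that \<open>GDERIV U x :> x\<close> unfolding gderiv_def by (rule has_derivative_unique)
    then show ?thesis by (metis inner_commute vector_eq_rdot)
  qed
  ultimately show ?thesis
    unfolding gradient_def by blast
qed

lemma is_solution_iff:
  "is_solution \<phi> x v \<longleftrightarrow> (\<forall>t\<ge>0. \<forall>i.
     ((\<lambda>s. x s $ i) has_vector_derivative v t $ i) (at t within {0..}) \<and>
     ((\<lambda>s. v s $ i) has_vector_derivative
        (1 / 2) *\<^sub>R (\<phi> (x t $ i - x t $ 1) *\<^sub>R (v t $ 1 - v t $ i)
          + \<phi> (x t $ i - x t $ 2) *\<^sub>R (v t $ 2 - v t $ i)) - x t $ i) (at t within {0..}))"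
  by (simp add: is_solution_def gradient_U sum_2)

text \<open>This isometry is the field of the free oscillator, which governs the sum of the two
  agents; it serves both existence and uniqueness.\<close>

lemma rotation_lipschitz: "1-lipschitz_on UNIV (\<lambda>z :: 'b \<times> 'b :: real_normed_vector. (snd z, - fst z))"
  by (intro lipschitz_onI)
     (auto simp: dist_prod_def dist_norm norm_minus_commute add.commute)

locale two_agents = alignment_kernel \<phi> r\<^sub>0 for \<phi> :: "real ^ 'n \<Rightarrow> real" and r\<^sub>0
begin

lemma even': "\<phi> (b - a) = \<phi> (a - b)"
  using even[of "a - b"] by simp

text \<open>Each agent contributes half of the drag and, \<phi> being even, the two halves add up in
  the difference, so the factor 1/2 disappears.\<close>

lemma relative_solution_if_is_solution:
  assumes "is_solution \<phi> x v"
  shows "relative_solution (\<lambda>t. x t $ 1 - x t $ 2) (\<lambda>t. v t $ 1 - v t $ 2)"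
  unfolding relative_solution_def
proof (intro allI impI conjI)
  fix t :: real assume t: "t \<ge> 0"
  note der = assms[unfolded is_solution_iff, rule_format, OF t]
  show "((\<lambda>t. x t $ 1 - x t $ 2) has_vector_derivative v t $ 1 - v t $ 2) (at t within {0..})"
    by (intro derivative_intros conjunct1[OF der])
  show "((\<lambda>t. v t $ 1 - v t $ 2) has_vector_derivative
      - (\<phi> (x t $ 1 - x t $ 2) *\<^sub>R (v t $ 1 - v t $ 2)) - (x t $ 1 - x t $ 2)) (at t within {0..})"
    by (rule has_vector_derivative_eq_rhs, rule has_vector_derivative_diff,
        (rule conjunct2[OF der])+)
       (simp add: even'[of "x t $ 1" "x t $ 2"] algebra_simps flip: scaleR_add_left)
qed

text \<open>As \<phi> is even, the mutual drags are opposite and cancel in the sum.\<close>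

lemma sum_has_vector_derivative_if_is_solution:
  assumes "is_solution \<phi> x v" and t: "t \<ge> 0"
  shows "((\<lambda>t. (x t $ 1 + x t $ 2, v t $ 1 + v t $ 2)) has_vector_derivative
    (v t $ 1 + v t $ 2, - (x t $ 1 + x t $ 2))) (at t within {0..})"
proof (rule has_vector_derivative_Pair)
  note der = assms(1)[unfolded is_solution_iff, rule_format, OF t]
  show "((\<lambda>t. x t $ 1 + x t $ 2) has_vector_derivative v t $ 1 + v t $ 2) (at t within {0..})"
    by (intro derivative_intros conjunct1[OF der])
  show "((\<lambda>t. v t $ 1 + v t $ 2) has_vector_derivative - (x t $ 1 + x t $ 2)) (at t within {0..})"
    by (rule has_vector_derivative_eq_rhs, rule has_vector_derivative_add,
        (rule conjunct2[OF der])+)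
       (simp add: even'[of "x t $ 1" "x t $ 2"] algebra_simps)
qed

lemma is_solution_unique:
  assumes sol: "is_solution \<phi> x v" "is_solution \<phi> x' v'"
    and init: "x 0 = x' 0" "v 0 = v' 0" and t: "t \<ge> 0"
  shows "x t = x' t \<and> v t = v' t"
proof -
  have "(x t $ 1 + x t $ 2, v t $ 1 + v t $ 2) = (x' t $ 1 + x' t $ 2, v' t $ 1 + v' t $ 2)"
    by (rule lipschitz_ode_unique[OF rotation_lipschitz _ _ _ t])
       (use sum_has_vector_derivative_if_is_solution sol init in auto)
  then have sum: "x t $ 1 + x t $ 2 = x' t $ 1 + x' t $ 2" "v t $ 1 + v t $ 2 = v' t $ 1 + v' t $ 2"
    by auto
  have diff: "x t $ 1 - x t $ 2 = x' t $ 1 - x' t $ 2" "v t $ 1 - v t $ 2 = v' t $ 1 - v' t $ 2"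
    using relative_solution_unique[OF sol[THEN relative_solution_if_is_solution] _ _ t] init by auto
  have halves: "a = c \<and> b = d" if "a + b = c + d" "a - b = c - d" for a b c d :: "real ^ 'n"
  proof -
    have "2 *\<^sub>R a = 2 *\<^sub>R c" "2 *\<^sub>R b = 2 *\<^sub>R d"
      using arg_cong2[OF that, of "(+)"] arg_cong2[OF that, of "(-)"]
      by (simp_all add: scaleR_2 algebra_simps)
    then show ?thesis by simp
  qed
  show ?thesis
    using halves[OF sum(1) diff(1)] halves[OF sum(2) diff(2)] by (auto simp: vec_eq_iff forall_2)
qed

text \<open>The equations for sum and difference are decoupled; they are solved separately, and the
  agents are recovered as half of sum plus or minus difference, with sign
  \<open>\<sigma> i\<close>.\<close>

lemma is_solution_exists:
  obtains x v where "is_solution \<phi> x v" "x 0 = x\<^sub>0" "v 0 = v\<^sub>0"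
proof -
  obtain y w where "relative_solution y w"
    and yw0: "y 0 = x\<^sub>0 $ 1 - x\<^sub>0 $ 2" "w 0 = v\<^sub>0 $ 1 - v\<^sub>0 $ 2"
    by (rule relative_solution_exists)
  then have y: "(y has_vector_derivative w t) (at t within {0..})"
    and w: "(w has_vector_derivative - (\<phi> (y t) *\<^sub>R w t) - y t) (at t within {0..})"
    if "t \<ge> 0" for t
    using that by (auto simp: relative_solution_def)
  obtain z where z0: "z 0 = (x\<^sub>0 $ 1 + x\<^sub>0 $ 2, v\<^sub>0 $ 1 + v\<^sub>0 $ 2)"
    and z: "\<And>t. t \<ge> 0 \<Longrightarrow> (z has_vector_derivative (snd (z t), - fst (z t))) (at t within {0..})"
    using lipschitz_ode_exists[OF rotation_lipschitz] by metis
  have m: "((\<lambda>t. fst (z t)) has_vector_derivative snd (z t)) (at t within {0..})"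
    and c: "((\<lambda>t. snd (z t)) has_vector_derivative - fst (z t)) (at t within {0..})" if "t \<ge> 0" for t
    using bounded_linear.has_vector_derivative[OF bounded_linear_fst z[OF that]]
      bounded_linear.has_vector_derivative[OF bounded_linear_snd z[OF that]] by simp_all
  define \<sigma> :: "2 \<Rightarrow> real" where "\<sigma> i = (if i = 1 then 1 else - 1)" for i
  define x where "x t = (\<chi> i. (1 / 2) *\<^sub>R (fst (z t) + \<sigma> i *\<^sub>R y t))" for t
  define v where "v t = (\<chi> i. (1 / 2) *\<^sub>R (snd (z t) + \<sigma> i *\<^sub>R w t))" for t
  have \<sigma>: "\<sigma> 1 = 1" "\<sigma> 2 = - 1" by (simp_all add: \<sigma>_def)
  have halves: "(1 / 2) *\<^sub>R (a + b) - (1 / 2) *\<^sub>R (a - b) = b" for a b :: "real ^ 'n"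
    by (simp flip: scaleR_diff_right scaleR_2)
  have half: "(1 / 2) *\<^sub>R (a + b + (a - b)) = a" "(1 / 2) *\<^sub>R (a + b - (a - b)) = b"
    for a b :: "real ^ 'n"
    by (simp_all flip: scaleR_2)
  have rel: "x t $ 1 - x t $ 2 = y t" "v t $ 1 - v t $ 2 = w t" for t
    by (simp_all add: x_def v_def \<sigma> halves)
  then have rel': "x t $ 2 - x t $ 1 = - y t" "v t $ 2 - v t $ 1 = - w t" for t
    by (metis minus_diff_eq)+
  have "is_solution \<phi> x v"
    unfolding is_solution_iff
  proof (intro allI impI conjI)
    fix t :: real and i :: 2 assume t: "t \<ge> 0"
    show "((\<lambda>s. x s $ i) has_vector_derivative v t $ i) (at t within {0..})"
      unfolding x_def v_def vec_lambda_beta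
      by (rule bounded_linear.has_vector_derivative[OF bounded_linear_scaleR_right]
          has_vector_derivative_add m y t)+
    have "((\<lambda>s. v s $ i) has_vector_derivative
        (1 / 2) *\<^sub>R (- fst (z t) + \<sigma> i *\<^sub>R (- (\<phi> (y t) *\<^sub>R w t) - y t))) (at t within {0..})"
      unfolding v_def vec_lambda_beta
      by (rule bounded_linear.has_vector_derivative[OF bounded_linear_scaleR_right]
          has_vector_derivative_add c w t)+
    also have "(1 / 2) *\<^sub>R (- fst (z t) + \<sigma> i *\<^sub>R (- (\<phi> (y t) *\<^sub>R w t) - y t)) =
        (1 / 2) *\<^sub>R (\<phi> (x t $ i - x t $ 1) *\<^sub>R (v t $ 1 - v t $ i)
          + \<phi> (x t $ i - x t $ 2) *\<^sub>R (v t $ 2 - v t $ i)) - x t $ i"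
      using exhaust_2[of i] by (auto simp: rel rel' even \<sigma>) (simp_all add: x_def \<sigma> algebra_simps)
    finally show "((\<lambda>s. v s $ i) has_vector_derivative \<dots>) (at t within {0..})" .
  qed
  moreover have "x 0 = x\<^sub>0" "v 0 = v\<^sub>0"
    by (simp_all add: vec_eq_iff[of "_ :: real ^ 'n ^ 2"] forall_2 x_def v_def \<sigma> z0 yw0 half)
  ultimately show ?thesis by (rule that)
qed

section \<open>From solutions to the flow\<close>

lemma flow_eq:
  assumes "is_solution \<phi> x v" "t \<ge> 0"
  shows "flow \<phi> (x 0, v 0) t = (x t, v t)"
  unfolding flow_def
proof (rule the_equality)
  fix z assume "\<exists>x' v'. is_solution \<phi> x' v' \<and> (x' 0, v' 0) = (x 0, v 0) \<and> (x' t, v' t) = z"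
  then show "z = (x t, v t)"
    using is_solution_unique[OF assms(1) _ _ _ assms(2)] by fastforce
next
  show "\<exists>x' v'. is_solution \<phi> x' v' \<and> (x' 0, v' 0) = (x 0, v 0) \<and> (x' t, v' t) = (x t, v t)"
    using assms(1) by (intro exI[of _ x] exI[of _ v]) simp
qed

lemma interacting_imp_aggregation:
  assumes "z\<^sub>0 \<notin> non_interacting \<phi> r\<^sub>0"
  shows "((\<lambda>t. norm (pos \<phi> z\<^sub>0 t $ 1 - pos \<phi> z\<^sub>0 t $ 2) + norm (vel \<phi> z\<^sub>0 t $ 1 - vel \<phi> z\<^sub>0 t $ 2))
      \<longlongrightarrow> 0) at_top"
proof -
  obtain x v where sol: "is_solution \<phi> x v" and "x 0 = fst z\<^sub>0" "v 0 = snd z\<^sub>0"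
    by (rule is_solution_exists)
  then have "z\<^sub>0 = (x 0, v 0)" by simp
  then have flow: "pos \<phi> z\<^sub>0 t = x t" "vel \<phi> z\<^sub>0 t = v t" if "t \<ge> 0" for t
    using flow_eq[OF sol that] by (simp_all add: pos_def vel_def)
  obtain T where "T \<ge> 0" "norm (x T $ 1 - x T $ 2) < r\<^sub>0"
    using assms by (auto simp: non_interacting_def flow not_le)
  with relative_solution_if_is_solution[OF sol]
  have "((\<lambda>t. norm (x t $ 1 - x t $ 2) + norm (v t $ 1 - v t $ 2)) \<longlongrightarrow> 0) at_top"
    by (rule relative_solution_tendsto_zero)
  \<comment> \<open>Solution and flow are compared at nonnegative times only, which suffices for a
    limit at infinity.\<close>
  moreover have "eventually (\<lambda>t. norm (x t $ 1 - x t $ 2) + norm (v t $ 1 - v t $ 2)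
      = norm (pos \<phi> z\<^sub>0 t $ 1 - pos \<phi> z\<^sub>0 t $ 2) + norm (vel \<phi> z\<^sub>0 t $ 1 - vel \<phi> z\<^sub>0 t $ 2)) at_top"
    using eventually_ge_at_top[of 0] by eventually_elim (simp add: flow)
  ultimately show ?thesis by (rule Lim_transform_eventually)
qed

end

theorem theorem4p3:
  fixes \<phi> :: "real ^ 'n \<Rightarrow> real" and r\<^sub>0 :: real
  assumes "r\<^sub>0 > 0"
    and "\<And>x. \<phi> x \<ge> 0"
    and "smooth \<phi>"
    and "radially_decreasing \<phi>"
    and "\<And>x. norm x < r\<^sub>0 \<Longrightarrow> \<phi> x > 0"
    and "\<And>x. norm x \<ge> r\<^sub>0 \<Longrightarrow> \<phi> x = 0"
  shows "AE z\<^sub>0 in lebesgue. z\<^sub>0 \<notin> non_interacting \<phi> r\<^sub>0 \<longrightarrow>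
    ((\<lambda>t. norm (pos \<phi> z\<^sub>0 t $ 1 - pos \<phi> z\<^sub>0 t $ 2) + norm (vel \<phi> z\<^sub>0 t $ 1 - vel \<phi> z\<^sub>0 t $ 2))
      \<longlongrightarrow> 0) at_top"
proof -
  interpret two_agents \<phi> r\<^sub>0
    by unfold_locales (use assms in auto)
  show ?thesis
    by (intro AE_I2 impI interacting_imp_aggregation)
qed

end
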